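(* Suppose $\lambda_a=1$, $0<\lambda_e<1$ and $|\lambda_{\max}(A)|>1$. Let the reference transmission policy be $$\mathbb{P}[\nu_{k+1}=1\mid \eta_k^s]=\begin{cases}1 & \eta_k^s>\bar t\\ 0 & \text{otherwise,}\end{cases}$$ where the threshold $\bar t\in\mathbb{N}$ satisfies $$\frac{1}{|\lambda_{\max}(A)|^{2(\bar t+1)}}<\lambda(1-\lambda_e).$$ If the detection horizon satisfies $N_r>\bar t$, then for every stealthy tolerance $\epsilon_{kl}>0$ there is no malicious transmission policy of the form $\mathbb{P}(\nu_{k+1}=1\mid \eta_k^s=i,\eta_k^e=j)=\tilde\tau_{ij}$, $i,j\in\mathbb{N}$, that simultaneously makes $J_e$ bounded (finite) and fulfills the stealthy constraint $\mathcal{KL}(\mathcal{P}_1\|\mathcal{P}_0)\le\epsilon_{kl}$.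
   Context: System: $x_{k+1}=Ax_k+w_k$, $y_k=Cx_k+v_k$, with $x_k\in\mathbb{R}^{n_s}$, $y_k\in\mathbb{R}^{n_y}$, $w_k,v_k$ mutually independent zero-mean (white) Gaussian noises with covariances $Q$ and $R$; $(C,A)$ is observable and $(A,\sqrt Q)$ is controllable. $\overline P$ is the steady-state posterior error covariance of the Kalman filter for $x_k$ given $y_0,\dots,y_k$. $f(X)=AXA^\top+Q$, $f^n$ is the $n$-fold composition, $f^0(X)=X$. $|\lambda_{\max}(A)|$ is the largest modulus of an eigenvalue of $A$. Channels: $\nu_k\in\{0,1\}$ is the transmission command. If $\nu_k=1$, the packet is received by the legitimate estimator ($\gamma_k=1$) with probability $\lambda$ and by the adversary ($\gamma^e_k=1$) with probability $\lambda_e$, independently of each other and over time; if $\nu_k=0$ nothing is received. If $\nu_k\gamma_k=1$, an acknowledgment (ACK) reaches the sensor ($\gamma_k^a=1$) with probability $\lambda_a$ (independently); otherwise $\gamma^a_k=0$. Holding times (initialised at $0$): $\eta^s_k=0$ if $\gamma^a_k=1$ and $\eta_k^s=\eta_{k-1}^s+1$ otherwise; $\eta^e_k=0$ if $\nu_k\gamma^e_k=1$ and $\eta^e_k=\eta^e_{k-1}+1$ otherwise. The adversary's error covariance is $P^e_k=f^{\eta^e_k}(\overline P)$ and $J_e=\lim_{T\to\infty}\frac1T\sum_{k=1}^T\mathrm{tr}(\mathbb{E}(P^e_k))$ (possibly $+\infty$). Before the intrusion the sensor uses the reference policy; after the intrusion it uses the malicious policy $(\tilde\tau_{ij})$ with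 $\tilde\tau_{ij}\in[0,1]$, and $J_e$ in the claim is evaluated under the malicious policy. For a positive integer $N_r$ let $o_{k+1:k+N_r}=(\nu_{k+1}\gamma_{k+1},\dots,\nu_{k+N_r}\gamma_{k+N_r})$. $\mathcal{P}_0$ and $\mathcal{P}_1$ are the (stationary) marginal distributions of $o_{k+1:k+N_r}$ before and after the intrusion, and $\mathcal{KL}(\mathcal{P}_1\|\mathcal{P}_0)=\sum_x\mathcal{P}_1(x)\log\frac{\mathcal{P}_1(x)}{\mathcal{P}_0(x)}$; the constraint is regarded as violated when this is not well-defined (some $x$ with $\mathcal{P}_1(x)>0=\mathcal{P}_0(x)$). *)

theory Defs
  imports "HOL-Analysis.Analysis" "HOL-Probability.Probability"
begin

section \<open>Linear systems\<close>

definition pos_semidef :: "real^'n^'n \<Rightarrow> bool" where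
  "pos_semidef M \<longleftrightarrow> transpose M = M \<and> (\<forall>v. 0 \<le> v \<bullet> (M *v v))"

text \<open>The power operation on the type of vectors is componentwise, hence a separate matrix power.\<close>

definition matrix_power :: "real^'n^'n \<Rightarrow> nat \<Rightarrow> real^'n^'n" where
  "matrix_power A i = (((**) A) ^^ i) (mat 1)"

text \<open>
  The next two definitions are the Kalman rank conditions. The rank of the block matrix
  \<open>[B, A B, \<dots>, A^(n-1) B]\<close> is the dimension of the span of the columns of all its blocks
  (cf. the library fact \<open>column_rank_def\<close>), and dually for the observability matrix.
\<close>

definition controllable :: "real^'n^'n \<Rightarrow> real^'m^'n \<Rightarrow> bool" where
  "controllable A B \<longleftrightarrow>
     dim (\<Union>i<CARD('n). columns (matrix_power A i ** B)) = CARD('n)"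

definition observable :: "real^'n^'m \<Rightarrow> real^'n^'n \<Rightarrow> bool" where
  "observable C A \<longleftrightarrow>
     dim (\<Union>i<CARD('n). rows (C ** matrix_power A i)) = CARD('n)"

definition complex_eigenvalues :: "real^'n^'n \<Rightarrow> complex set" where
  "complex_eigenvalues A =
     {\<mu>. \<exists>v. v \<noteq> 0 \<and> map_matrix complex_of_real A *v v = \<mu> *s v}"

definition max_eigenvalue_modulus :: "real^'n^'n \<Rightarrow> real" where
  "max_eigenvalue_modulus A = Max (cmod ` complex_eigenvalues A)"

section \<open>Kalman filter error covariances\<close>

definition predict_cov :: "real^'n^'n \<Rightarrow> real^'n^'n \<Rightarrow> real^'n^'n \<Rightarrow> real^'n^'n" where
  "predict_cov A Q X = A ** X ** transpose A + Q"

text \<open>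
  Measurement update of a prior error covariance \<open>M\<close>. The matrix \<open>K\<close> is the Kalman gain,
  \<open>K = M C^T (C M C^T + R)^(-1)\<close> whenever the innovation covariance is invertible. Stating the
  gain by its normal equation also covers a singular measurement noise covariance, and the
  resulting posterior covariance does not depend on the solution \<open>K\<close> chosen
  (for positive semidefinite \<open>M\<close> and \<open>R\<close>).
\<close>

definition measurement_update ::
  "real^'n^'m \<Rightarrow> real^'m^'m \<Rightarrow> real^'n^'n \<Rightarrow> real^'n^'n \<Rightarrow> bool" where
  "measurement_update C R M P \<longleftrightarrow>
     (\<exists>K. K ** (C ** M ** transpose C + R) = M ** transpose C \<and> P = M - K ** C ** M)"

text \<open>
  \<open>P k\<close> is the error covariance of the estimate of the state \<open>x\<^sub>k\<close> given \<open>y\<^sub>0, \<dots>, y\<^sub>k\<close>, where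
  \<open>\<Sigma>\<close> is the covariance of \<open>x\<^sub>0\<close>.
\<close>

definition kalman_posterior_covs ::
  "real^'n^'n \<Rightarrow> real^'n^'m \<Rightarrow> real^'n^'n \<Rightarrow> real^'m^'m \<Rightarrow> real^'n^'n \<Rightarrow> (nat \<Rightarrow> real^'n^'n) \<Rightarrow> bool"
  where
  "kalman_posterior_covs A C Q R \<Sigma> P \<longleftrightarrow>
     measurement_update C R \<Sigma> (P 0) \<and>
     (\<forall>k. measurement_update C R (predict_cov A Q (P k)) (P (Suc k)))"

section \<open>Transmission policies and holding times\<close>

text \<open>
  \<open>\<tau> i j\<close> is the probability of the command \<open>\<nu>\<^sub>k\<^sub>+\<^sub>1 = 1\<close> when the holding times at time \<open>k\<close>
  of the sensor and the adversary are \<open>i\<close> and \<open>j\<close>.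
\<close>

type_synonym policy = "nat \<Rightarrow> nat \<Rightarrow> real"

definition threshold_policy :: "nat \<Rightarrow> policy" where
  "threshold_policy t i j = (if i > t then 1 else 0)"

text \<open>
  One time step from the holding times \<open>(i, j)\<close>: the joint law of the observed symbol
  \<open>\<nu> \<and> \<gamma>\<close> and of the new pair of holding times. The parameters \<open>lam\<close>, \<open>lame\<close>, \<open>lama\<close> are the
  success probabilities of the channels to the estimator, to the adversary and of the
  acknowledgment. Beware that \<open>bernoulli_pmf\<close> clips its parameter to \<open>[0,1]\<close>.
\<close>

definition step_law ::
  "real \<Rightarrow> real \<Rightarrow> real \<Rightarrow> policy \<Rightarrow> nat \<times> nat \<Rightarrow> (bool \<times> nat \<times> nat) pmf" where
  "step_law lam lame lama \<tau> = (\<lambda>(i, j).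
     bind_pmf (bernoulli_pmf (\<tau> i j)) (\<lambda>\<nu>.
     bind_pmf (if \<nu> then bernoulli_pmf lam else return_pmf False) (\<lambda>\<gamma>.
     bind_pmf (if \<nu> then bernoulli_pmf lame else return_pmf False) (\<lambda>\<gamma>e.
     bind_pmf (if \<nu> \<and> \<gamma> then bernoulli_pmf lama else return_pmf False) (\<lambda>\<gamma>a.
       return_pmf (\<nu> \<and> \<gamma>,
                   if \<gamma>a then 0 else i + 1,
                   if \<nu> \<and> \<gamma>e then 0 else j + 1))))))"

fun holding_law :: "real \<Rightarrow> real \<Rightarrow> real \<Rightarrow> policy \<Rightarrow> nat \<Rightarrow> (nat \<times> nat) pmf" where
  "holding_law lam lame lama \<tau> 0 = return_pmf (0, 0)"
| "holding_law lam lame lama \<tau> (Suc k) =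
     bind_pmf (holding_law lam lame lama \<tau> k) (\<lambda>s. map_pmf snd (step_law lam lame lama \<tau> s))"

definition stationary_law ::
  "real \<Rightarrow> real \<Rightarrow> real \<Rightarrow> policy \<Rightarrow> (nat \<times> nat) pmf \<Rightarrow> bool" where
  "stationary_law lam lame lama \<tau> \<pi> \<longleftrightarrow>
     bind_pmf \<pi> (\<lambda>s. map_pmf snd (step_law lam lame lama \<tau> s)) = \<pi>"

text \<open>The law of the next \<open>N\<close> observed symbols, started in given holding times.\<close>

fun window_law ::
  "real \<Rightarrow> real \<Rightarrow> real \<Rightarrow> policy \<Rightarrow> nat \<Rightarrow> nat \<times> nat \<Rightarrow> bool list pmf" where
  "window_law lam lame lama \<tau> 0 s = return_pmf []"
| "window_law lam lame lama \<tau> (Suc N) s =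
     bind_pmf (step_law lam lame lama \<tau> s)
       (\<lambda>(b, s'). map_pmf ((#) b) (window_law lam lame lama \<tau> N s'))"

definition stationary_window_law ::
  "real \<Rightarrow> real \<Rightarrow> real \<Rightarrow> policy \<Rightarrow> nat \<Rightarrow> bool list pmf \<Rightarrow> bool" where
  "stationary_window_law lam lame lama \<tau> N \<P> \<longleftrightarrow>
     (\<exists>\<pi>. stationary_law lam lame lama \<tau> \<pi> \<and> \<P> = bind_pmf \<pi> (window_law lam lame lama \<tau> N))"

section \<open>Stealthiness and the error of the adversary\<close>

definition KL_sum :: "nat \<Rightarrow> bool list pmf \<Rightarrow> bool list pmf \<Rightarrow> real" where
  "KL_sum N \<P>1 \<P>0 = (\<Sum>x | length x = N. pmf \<P>1 x * ln (pmf \<P>1 x / pmf \<P>0 x))"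

text \<open>
  The inclusion of supports says that the divergence is well-defined; without it, division
  by zero would make \<open>KL_sum\<close> a meaningless finite number.
\<close>

definition stealthy ::
  "real \<Rightarrow> real \<Rightarrow> real \<Rightarrow> policy \<Rightarrow> policy \<Rightarrow> nat \<Rightarrow> real \<Rightarrow> bool" where
  "stealthy lam lame lama \<tau>0 \<tau>1 N \<epsilon> \<longleftrightarrow>
     (\<exists>\<P>0 \<P>1. stationary_window_law lam lame lama \<tau>0 N \<P>0 \<and>
             stationary_window_law lam lame lama \<tau>1 N \<P>1 \<and>
             set_pmf \<P>1 \<subseteq> set_pmf \<P>0 \<and> KL_sum N \<P>1 \<P>0 \<le> \<epsilon>)"

text \<open>
  The holding time of the adversary at time \<open>k\<close> is at most \<open>k\<close>, so the expectation below is a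
  finite sum.
\<close>

definition adversary_expected_cov ::
  "real \<Rightarrow> real \<Rightarrow> real \<Rightarrow> policy \<Rightarrow> real^'n^'n \<Rightarrow> real^'n^'n \<Rightarrow> real^'n^'n \<Rightarrow> nat \<Rightarrow> real^'n^'n" where
  "adversary_expected_cov lam lame lama \<tau> A Q Pbar k =
     measure_pmf.expectation (holding_law lam lame lama \<tau> k)
       (\<lambda>(i, j). (predict_cov A Q ^^ j) Pbar)"

definition adversary_average_cost ::
  "real \<Rightarrow> real \<Rightarrow> real \<Rightarrow> policy \<Rightarrow> real^'n^'n \<Rightarrow> real^'n^'n \<Rightarrow> real^'n^'n \<Rightarrow> nat \<Rightarrow> real" where
  "adversary_average_cost lam lame lama \<tau> A Q Pbar T =
     (\<Sum>k=1..T. trace (adversary_expected_cov lam lame lama \<tau> A Q Pbar k)) / real T"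

text \<open>
  \<open>J\<^sub>e\<close> is the limit of the average costs; convergence in the reals means that the limit exists
  and is not \<open>+\<infinity>\<close>.
\<close>

definition adversary_cost_finite ::
  "real \<Rightarrow> real \<Rightarrow> real \<Rightarrow> policy \<Rightarrow> real^'n^'n \<Rightarrow> real^'n^'n \<Rightarrow> real^'n^'n \<Rightarrow> bool" where
  "adversary_cost_finite lam lame lama \<tau> A Q Pbar \<longleftrightarrow>
     convergent (adversary_average_cost lam lame lama \<tau> A Q Pbar)"

end

theory Submission
  imports Defs "HOL-Computational_Algebra.Fundamental_Theorem_Algebra"
begin

text \<open>
  Along a left eigenvector of \<open>A\<close> of maximal modulus \<open>\<rho>\<close>, controllability makes the noise
  nondegenerate, so \<open>tr (f^j Pbar)\<close> is at least of order \<open>\<rho>^(2j)\<close>.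
  A finite divergence forces the support of the windows under the malicious policy into that of the
  reference policy, under which two receptions are more than \<open>t\<close> steps apart; as every
  transmission may be received, the sensor must be silent for \<open>t\<close> steps after each reception.
  Hence, whenever the sensor transmits while the adversary's holding time is at least the sensor's,
  then with probability at least \<open>p = lam (1 - lame)\<close> there is a new reception, missed by the
  adversary, at which the adversary's holding time has grown by at least \<open>t + 1\<close> since the
  previous reception. So receptions with adversary holding time at least
  \<open>m (t + 1)\<close> have a frequency of order at least \<open>p^m\<close>, each with cost
  of order \<open>\<rho>^(2m(t+1))\<close>; as \<open>p \<rho>^(2(t+1)) > 1\<close>, the
  average cost is unbounded. The stationary law required by stealthiness makes the origin, where
  the chain starts, a positively recurrent state, which gives the case \<open>m = 0\<close>.
\<close>

section \<open>Eigenvalues of real matrices\<close>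

lemma matrix_kernel_iff_det:
  fixes B :: "'a::field^'n^'n"
  shows "(\<exists>v. v \<noteq> 0 \<and> B *v v = 0) \<longleftrightarrow> det B = 0"
  by (metis invertible_det_nz invertible_left_inverse matrix_left_invertible_ker)

lemma mat_diff_mult_vec:
  fixes B :: "'a::field^'n^'n"
  shows "(mat z - B) *v v = z *s v - B *v v"
proof -
  have "mat z *v v = z *s v"
    by (simp add: vec_eq_iff matrix_vector_mult_def mat_def if_distrib if_distribR cong: if_cong)
  then show ?thesis by (simp add: matrix_vector_mult_diff_rdistrib)
qed

text \<open>Evaluation at \<open>z\<close> is a ring homomorphism, so it commutes with the Leibniz
  expansion of a determinant with polynomial entries.\<close>

lemma char_poly_exists:
  fixes B :: "complex^'n^'n"
  obtains p :: "complex poly" where "\<And>z. poly p z = det (mat z - B)"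
proof
  fix z
  show "poly (det (\<chi> i j. if i = j then [:- B $ i $ j, 1:] else [:- B $ i $ j:])) z = det (mat z - B)"
    unfolding det_def by (auto simp: poly_sum poly_prod mat_def intro!: sum.cong prod.cong)
qed

lemma det_scale:
  fixes B :: "'a::field^'n^'n"
  shows "det (\<chi> i j. c * B $ i $ j) = c ^ CARD('n) * det B"
  by (simp add: det_def prod.distrib sum_distrib_left mult_ac)
text \<open>Putting \<open>z = 1 / w\<close> and clearing denominators gives
  \<open>det (1 - w B) = w ^ n * c\<close> for nonzero \<open>w\<close>. As \<open>w\<close> tends
  to 0, the left side tends to 1 and the right side to 0.\<close>

lemma char_poly_not_constant:
  fixes B :: "complex^'n^'n"
  assumes "\<And>z. det (mat z - B) = c"
  shows False
proof -
  have eq: "det (mat 1 - (\<chi> i j. w * B $ i $ j)) = w ^ CARD('n) * c" if "w \<noteq> 0" for w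
  proof -
    have "mat 1 - (\<chi> i j. w * B $ i $ j) = (\<chi> i j. w * (mat (1 / w) - B) $ i $ j)"
      using that by (auto simp: vec_eq_iff mat_def algebra_simps)
    then show ?thesis using assms det_scale[of w "mat (1 / w) - B"] by simp
  qed
  have "isCont (\<lambda>w. det (mat 1 - (\<chi> i j. w * B $ i $ j))) 0"
    unfolding det_def by (auto intro!: continuous_intros)
  moreover have "det (mat 1 - (\<chi> i j. 0 * B $ i $ j)) = 1"
    by (metis (no_types, lifting) det_I diff_zero mult_zero_left vec_lambda_unique zero_index)
  ultimately have "((\<lambda>w. det (mat 1 - (\<chi> i j. w * B $ i $ j))) \<longlongrightarrow> 1) (at 0)"
    by (simp add: isCont_def)
  moreover have "((\<lambda>w. w ^ CARD('n) * c) \<longlongrightarrow> 0 ^ CARD('n) * c) (at (0::complex))"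
    by (intro tendsto_intros)
  then have "((\<lambda>w. det (mat 1 - (\<chi> i j. w * B $ i $ j))) \<longlongrightarrow> 0) (at 0)"
    using eq by (auto simp: zero_power eventually_at_filter elim!: Lim_transform_eventually)
  ultimately show False
    using tendsto_unique[OF at_neq_bot] by fastforce
qed

text \<open>Eigenvalues are the roots of a nonconstant polynomial. Both facts together make the
  \<open>Max\<close> in \<open>max_eigenvalue_modulus\<close> an attained maximum.\<close>

lemma complex_eigenvalues_finite_nonempty:
  "finite (complex_eigenvalues A)" "complex_eigenvalues A \<noteq> {}"
proof -
  let ?B = "map_matrix complex_of_real A"
  obtain p where p: "\<And>z. poly p z = det (mat z - ?B)" using char_poly_exists by blast
  have eig: "complex_eigenvalues A = {z. poly p z = 0}"
    unfolding complex_eigenvalues_def p matrix_kernel_iff_det[symmetric] mat_diff_mult_vec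
    by (auto simp: algebra_simps)
  show "finite (complex_eigenvalues A)"
    unfolding eig using char_poly_not_constant[of ?B 0] p poly_roots_finite[of p] by fastforce
  have "\<not> constant (poly p)"
    using char_poly_not_constant[of ?B] p unfolding constant_def by metis
  then show "complex_eigenvalues A \<noteq> {}"
    unfolding eig using fundamental_theorem_of_algebra by blast
qed

text \<open>Transposition preserves determinants, so an eigenvalue \<open>x + i y\<close> of maximal
  modulus has a left eigenvector \<open>a + i b\<close>. Splitting it into real and imaginary parts
  keeps the later work over the reals.\<close>

lemma left_eigenvector_max_modulus:
  fixes A :: "real^'n^'n"
  obtains a b :: "real^'n" and x y :: real where
    "a \<noteq> 0 \<or> b \<noteq> 0" "x\<^sup>2 + y\<^sup>2 = (max_eigenvalue_modulus A)\<^sup>2"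
    "transpose A *v a = x *\<^sub>R a - y *\<^sub>R b" "transpose A *v b = y *\<^sub>R a + x *\<^sub>R b"
proof -
  let ?B = "map_matrix complex_of_real A"
  have "max_eigenvalue_modulus A \<in> cmod ` complex_eigenvalues A"
    unfolding max_eigenvalue_modulus_def
    by (intro Max_in finite_imageI) (simp_all add: complex_eigenvalues_finite_nonempty)
  then obtain z where z: "z \<in> complex_eigenvalues A" "cmod z = max_eigenvalue_modulus A" by auto
  from z have "\<exists>v. v \<noteq> 0 \<and> (mat z - ?B) *v v = 0"
    unfolding complex_eigenvalues_def mat_diff_mult_vec by auto
  then have "det (transpose (mat z - ?B)) = 0" by (simp add: matrix_kernel_iff_det det_transpose)
  moreover have "transpose (mat z - ?B) = mat z - transpose ?B"
    by (auto simp: transpose_def mat_def vec_eq_iff)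
  ultimately obtain v where v: "v \<noteq> 0" "transpose ?B *v v = z *s v"
    unfolding matrix_kernel_iff_det[symmetric] by (auto simp: mat_diff_mult_vec)
  define a where "a = (\<chi> i. Re (v $ i))"
  define b where "b = (\<chi> i. Im (v $ i))"
  have vi: "(\<Sum>j\<in>UNIV. complex_of_real (A $ j $ i) * v $ j) = z * v $ i" for i
    using v(2) by (auto simp: vec_eq_iff matrix_vector_mult_def transpose_def map_matrix_def)
  show thesis
  proof
    show "a \<noteq> 0 \<or> b \<noteq> 0" using v(1) by (auto simp: a_def b_def vec_eq_iff complex_eq_iff)
    show "(Re z)\<^sup>2 + (Im z)\<^sup>2 = (max_eigenvalue_modulus A)\<^sup>2"
      using z(2) by (simp add: cmod_power2[symmetric])
    show "transpose A *v a = Re z *\<^sub>R a - Im z *\<^sub>R b"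
      using arg_cong[OF vi, of Re]
      by (auto simp: vec_eq_iff matrix_vector_mult_def transpose_def a_def b_def)
    show "transpose A *v b = Im z *\<^sub>R a + Re z *\<^sub>R b"
      using arg_cong[OF vi, of Im]
      by (auto simp: vec_eq_iff matrix_vector_mult_def transpose_def a_def b_def)
  qed
qed
section \<open>Growth of the error covariance\<close>

lemma transpose_add: "transpose (X + Y) = transpose X + transpose (Y :: real^'n^'m)"
  by (simp add: transpose_def vec_eq_iff)

lemma transpose_diff: "transpose (X - Y) = transpose X - transpose (Y :: real^'n^'m)"
  by (simp add: transpose_def vec_eq_iff)

lemma matrix_diff_ldistrib: "A ** (X - Y) = A ** X - A ** (Y :: real^'k^'n)"
  by (vector matrix_matrix_mult_def sum_subtractf right_diff_distrib)

lemma matrix_diff_rdistrib: "(X - Y) ** A = X ** A - Y ** (A :: real^'k^'n)"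
  by (vector matrix_matrix_mult_def sum_subtractf left_diff_distrib)

lemma inner_matrix_vector_transpose:
  fixes A :: "real^'n^'m"
  shows "v \<bullet> (A *v w) = (transpose A *v v) \<bullet> w"
  by (metis dot_lmul_matrix vector_transpose_matrix transpose_transpose)

lemma inner_congruence:
  fixes A :: "real^'n^'m"
  shows "v \<bullet> ((A ** X ** transpose A) *v w) = (transpose A *v v) \<bullet> (X *v (transpose A *v w))"
  by (simp add: inner_matrix_vector_transpose flip: matrix_vector_mul_assoc)

lemma pos_semidef_congruence:
  "pos_semidef X \<Longrightarrow> pos_semidef (A ** X ** transpose A)"
  unfolding pos_semidef_def inner_congruence
  by (simp add: matrix_transpose_mul matrix_mul_assoc)

lemma pos_semidef_add: "pos_semidef X \<Longrightarrow> pos_semidef Y \<Longrightarrow> pos_semidef (X + Y)"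
  unfolding pos_semidef_def
  by (simp add: transpose_add matrix_vector_mult_add_rdistrib inner_add_right)

lemma pos_semidef_predict_cov:
  "pos_semidef Q \<Longrightarrow> pos_semidef X \<Longrightarrow> pos_semidef (predict_cov A Q X)"
  unfolding predict_cov_def by (intro pos_semidef_add pos_semidef_congruence)

text \<open>The posterior covariance in Joseph form is a sum of two congruences.\<close>

lemma pos_semidef_measurement_update:
  assumes "pos_semidef M" "pos_semidef R" "measurement_update C R M P"
  shows "pos_semidef P"
proof -
  obtain K where K: "K ** (C ** M ** transpose C + R) = M ** transpose C"
    and P: "P = M - K ** C ** M"
    using assms(3) unfolding measurement_update_def by blast
  let ?L = "mat 1 - K ** C"
  have "K ** R = M ** transpose C - K ** C ** M ** transpose C"
    using K by (simp add: matrix_add_ldistrib matrix_mul_assoc algebra_simps)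
  then have "P = ?L ** M ** transpose ?L + K ** R ** transpose K"
    unfolding P by (simp add: transpose_diff matrix_transpose_mul transpose_mat
        matrix_diff_ldistrib matrix_diff_rdistrib matrix_mul_assoc)
  with assms(1,2) show ?thesis by (metis pos_semidef_add pos_semidef_congruence)
qed

lemma pos_semidef_limit:
  assumes "\<And>k. pos_semidef (X k)" "X \<longlonglongrightarrow> L"
  shows "pos_semidef L"
proof -
  have nth: "(\<lambda>k. X k $ i $ j) \<longlonglongrightarrow> L $ i $ j" for i j
    using assms(2) by (intro tendsto_vec_nth)
  have "X k $ i $ j = X k $ j $ i" for k i j
    using assms(1)[of k] unfolding pos_semidef_def by (metis transpose_def vec_lambda_beta)
  then have "L $ i $ j = L $ j $ i" for i j
    using LIMSEQ_unique[OF nth[of i j]] nth[of j i] by simp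
  then have "transpose L = L" by (simp add: transpose_def vec_eq_iff)
  moreover have "0 \<le> v \<bullet> (L *v v)" for v
  proof (rule LIMSEQ_le_const)
    show "(\<lambda>k. v \<bullet> (X k *v v)) \<longlonglongrightarrow> v \<bullet> (L *v v)"
      unfolding inner_vec_def matrix_vector_mult_def by (auto intro!: tendsto_intros nth)
    show "\<exists>N. \<forall>n\<ge>N. 0 \<le> v \<bullet> (X n *v v)" using assms(1) unfolding pos_semidef_def by blast
  qed
  ultimately show ?thesis unfolding pos_semidef_def by blast
qed

lemma pos_semidef_kalman_limit:
  assumes "pos_semidef Q" "pos_semidef R" "pos_semidef \<Sigma>"
    and "kalman_posterior_covs A C Q R \<Sigma> P" "P \<longlonglongrightarrow> Pbar"
  shows "pos_semidef Pbar"
proof (rule pos_semidef_limit[OF _ assms(5)])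
  show "pos_semidef (P k)" for k
    using assms(1-4) unfolding kalman_posterior_covs_def
    by (induction k) (blast intro: pos_semidef_measurement_update pos_semidef_predict_cov)+
qed

text \<open>Testing the form on the sum and the difference of two basis vectors bounds twice the
  entry by two diagonal entries, each at most the trace.\<close>

lemma pos_semidef_entry_le_trace:
  fixes X :: "real^'n^'n"
  assumes "pos_semidef X"
  shows "\<bar>X $ i $ j\<bar> \<le> trace X"
proof -
  have entry: "axis k 1 \<bullet> (X *v axis l 1) = X $ k $ l" for k l
    by (simp add: inner_axis' matrix_vector_mult_basis column_def)
  have sym: "X $ k $ l = X $ l $ k" for k l
    using assms unfolding pos_semidef_def by (metis transpose_def vec_lambda_beta)
  have nonneg: "0 \<le> v \<bullet> (X *v v)" for v using assms unfolding pos_semidef_def by blast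
  have diag: "0 \<le> X $ k $ k" for k using nonneg[of "axis k 1"] by (simp add: entry)
  then have diag_le: "X $ k $ k \<le> trace X" for k
    unfolding trace_def by (intro member_le_sum) auto
  have "0 \<le> X $ i $ i + X $ j $ j + 2 * X $ i $ j"
    using nonneg[of "axis i 1 + axis j 1"] sym[of i j]
    by (simp add: entry matrix_vector_right_distrib inner_add_left inner_add_right)
  moreover have "0 \<le> X $ i $ i + X $ j $ j - 2 * X $ i $ j"
    using nonneg[of "axis i 1 - axis j 1"] sym[of i j]
    by (simp add: entry matrix_vector_mult_diff_distrib inner_diff_left inner_diff_right)
  ultimately show ?thesis using diag_le[of i] diag_le[of j] by linarith
qed

lemma pos_semidef_form_le_trace:
  fixes X :: "real^'n^'n"
  assumes "pos_semidef X"
  shows "v \<bullet> (X *v v) \<le> (\<Sum>i\<in>UNIV. \<bar>v $ i\<bar>)\<^sup>2 * trace X"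
proof -
  have "v \<bullet> (X *v v) = (\<Sum>i\<in>UNIV. \<Sum>j\<in>UNIV. v $ i * v $ j * X $ i $ j)"
    by (simp add: inner_vec_def matrix_vector_mult_def sum_distrib_left mult_ac)
  also have "\<dots> \<le> (\<Sum>i\<in>UNIV. \<Sum>j\<in>UNIV. \<bar>v $ i\<bar> * \<bar>v $ j\<bar> * trace X)"
  proof (intro sum_mono)
    fix i j
    have "v $ i * v $ j * X $ i $ j \<le> \<bar>v $ i * v $ j * X $ i $ j\<bar>" by simp
    also have "\<dots> \<le> \<bar>v $ i\<bar> * \<bar>v $ j\<bar> * trace X"
      using pos_semidef_entry_le_trace[OF assms, of i j] by (simp add: abs_mult mult_left_mono)
    finally show "v $ i * v $ j * X $ i $ j \<le> \<bar>v $ i\<bar> * \<bar>v $ j\<bar> * trace X" .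
  qed
  also have "\<dots> = (\<Sum>i\<in>UNIV. \<bar>v $ i\<bar>)\<^sup>2 * trace X"
    by (simp add: power2_eq_square sum_product) (simp add: sum_distrib_right)
  finally show ?thesis .
qed

text \<open>Otherwise \<open>S\<close> annihilates \<open>a\<close> and \<open>b\<close>. Their span
  is invariant under \<open>transpose A\<close>, so both are orthogonal to all columns of all
  \<open>A^i S\<close>; by controllability these span the space, forcing
  \<open>a = b = 0\<close>.\<close>

lemma left_eigenpair_noise_pos:
  fixes A S :: "real^'n^'n"
  assumes "controllable A S" and "transpose S = S" and "a \<noteq> 0 \<or> b \<noteq> 0"
    and a: "transpose A *v a = x *\<^sub>R a - y *\<^sub>R b" and b: "transpose A *v b = y *\<^sub>R a + x *\<^sub>R b"
  shows "0 < a \<bullet> ((S ** S) *v a) + b \<bullet> ((S ** S) *v b)"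
proof (rule ccontr)
  have SS: "v \<bullet> ((S ** S) *v v) = (norm (S *v v))\<^sup>2" for v
    using assms(2) by (metis inner_matrix_vector_transpose matrix_vector_mul_assoc power2_norm_eq_inner)
  assume "\<not> ?thesis"
  then have "(norm (S *v a))\<^sup>2 + (norm (S *v b))\<^sup>2 \<le> 0" unfolding SS by simp
  then have S0: "S *v a = 0" "S *v b = 0"
    by (metis add_nonneg_nonneg antisym norm_eq_zero sum_power2_eq_zero_iff zero_le_power2)+
  have orth: "a \<bullet> (matrix_power A i *v (S *v v)) = 0 \<and> b \<bullet> (matrix_power A i *v (S *v v)) = 0" for i v
  proof (induction i)
    case 0
    then show ?case using S0 assms(2)
      by (simp add: matrix_power_def inner_matrix_vector_transpose)
  next
    case (Suc i)
    have "matrix_power A (Suc i) *v (S *v v) = A *v (matrix_power A i *v (S *v v))"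
      by (simp add: matrix_power_def matrix_vector_mul_assoc matrix_mul_assoc)
    with Suc show ?case
      by (simp add: inner_matrix_vector_transpose[of _ A] a b inner_diff_left inner_add_left
          del: transpose_matrix_vector)
  qed
  let ?W = "\<Union>i<CARD('n). columns (matrix_power A i ** S)"
  have W: "span ?W = UNIV"
    using assms(1) unfolding controllable_def by (simp flip: dim_eq_full)
  have col: "c \<bullet> w = 0" if "w \<in> ?W" "c = a \<or> c = b" for c w
    using that orth by (force simp: columns_def simp flip: matrix_vector_mult_basis matrix_vector_mul_assoc)
  have "orthogonal c c" if "c = a \<or> c = b" for c
    using orthogonal_to_span[of c ?W c] col that W by (auto simp: orthogonal_def)
  with assms(3) show False by (auto simp: orthogonal_def)
qed

text \<open>Along the left eigenvector, each prediction multiplies the quadratic form by the squared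
  modulus and adds a positive noise term. The bound starts at \<open>j = 1\<close> because
  \<open>X\<close> may vanish in this direction.\<close>

lemma trace_iterated_predict_cov_ge:
  fixes A Q S X :: "real^'n^'n"
  assumes "pos_semidef X" "pos_semidef S" "S ** S = Q" "controllable A S"
    and "max_eigenvalue_modulus A \<noteq> 0"
  obtains c where "0 < c"
    "\<And>j. 1 \<le> j \<Longrightarrow> c * max_eigenvalue_modulus A ^ (2 * j) \<le> trace ((predict_cov A Q ^^ j) X)"
    "\<And>j. 0 \<le> trace ((predict_cov A Q ^^ j) X)"
proof -
  let ?r = "max_eigenvalue_modulus A"
  obtain a b x y where ab: "a \<noteq> 0 \<or> b \<noteq> 0" and r: "x\<^sup>2 + y\<^sup>2 = ?r\<^sup>2"
    and ea: "transpose A *v a = x *\<^sub>R a - y *\<^sub>R b" and eb: "transpose A *v b = y *\<^sub>R a + x *\<^sub>R b"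
    using left_eigenvector_max_modulus by blast
  \<comment> \<open>This is the real part of the Hermitian form of \<open>Y\<close> at the complex
    vector \<open>a + i b\<close>.\<close>
  define q where "q Y = a \<bullet> (Y *v a) + b \<bullet> (Y *v b)" for Y :: "real^'n^'n"
  have S: "transpose S = S" using assms(2) unfolding pos_semidef_def by blast
  have "pos_semidef (S ** mat 1 ** transpose S)"
    by (intro pos_semidef_congruence) (simp add: pos_semidef_def transpose_mat)
  then have Q: "pos_semidef Q" using S assms(3) by simp
  have psd: "pos_semidef ((predict_cov A Q ^^ j) X)" for j
    by (induction j) (simp_all add: assms(1) Q pos_semidef_predict_cov)
  have qQ: "0 < q Q"
    using left_eigenpair_noise_pos[OF assms(4) S ab ea eb] assms(3) by (simp add: q_def)
  have step: "q (predict_cov A Q Y) = ?r\<^sup>2 * q Y + q Q" for Y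
  proof -
    have "q (predict_cov A Q Y) = (x *\<^sub>R a - y *\<^sub>R b) \<bullet> (Y *v (x *\<^sub>R a - y *\<^sub>R b))
        + (y *\<^sub>R a + x *\<^sub>R b) \<bullet> (Y *v (y *\<^sub>R a + x *\<^sub>R b)) + q Q"
      by (simp add: q_def predict_cov_def matrix_vector_mult_add_rdistrib inner_add_right
          inner_congruence ea eb del: transpose_matrix_vector)
    \<comment> \<open>The mixed terms in \<open>a\<close> and \<open>b\<close> cancel:
      \<open>transpose A\<close> acts on the pair as a scaled rotation.\<close>
    also have "\<dots> = (x\<^sup>2 + y\<^sup>2) * q Y + q Q"
      by (simp add: q_def matrix_vector_right_distrib matrix_vector_mult_diff_distrib
          matrix_vector_mult_scaleR inner_add_left inner_add_right inner_diff_left inner_diff_right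
          power2_eq_square algebra_simps)
    finally show ?thesis unfolding r .
  qed
  have q_ge: "q Q * ?r ^ (2 * j) \<le> q ((predict_cov A Q ^^ Suc j) X)" for j
  proof (induction j)
    case 0
    have "0 \<le> q X" using assms(1) unfolding q_def pos_semidef_def by simp
    then show ?case by (simp add: step)
  next
    case (Suc j)
    have "q Q * ?r ^ (2 * Suc j) = ?r\<^sup>2 * (q Q * ?r ^ (2 * j))"
      by (simp add: power2_eq_square)
    also have "\<dots> \<le> ?r\<^sup>2 * q ((predict_cov A Q ^^ Suc j) X)"
      using Suc by (intro mult_left_mono) auto
    finally show ?case using qQ by (simp add: step)
  qed
  define d where "d = (\<Sum>i\<in>UNIV. \<bar>a $ i\<bar>)\<^sup>2 + (\<Sum>i\<in>UNIV. \<bar>b $ i\<bar>)\<^sup>2"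
  have q_le: "q Y \<le> d * trace Y" if "pos_semidef Y" for Y
    unfolding q_def d_def using pos_semidef_form_le_trace[OF that, of a]
      pos_semidef_form_le_trace[OF that, of b] by (simp add: algebra_simps)
  have trace_nonneg: "0 \<le> trace Y" if "pos_semidef Y" for Y :: "real^'n^'n"
    using pos_semidef_entry_le_trace[OF that, of undefined undefined] by linarith
  have "d \<noteq> 0" using qQ q_le[OF Q] by auto
  then have d: "0 < d" unfolding d_def
    by (metis add_nonneg_nonneg less_eq_real_def zero_le_power2)
  have r0: "0 < ?r\<^sup>2" using assms(5) by simp
  show thesis
  proof
    \<comment> \<open>The squared modulus in the denominator compensates for the growth starting
      only after the first step.\<close>
    show "0 < q Q / (d * ?r\<^sup>2)" using qQ d r0 by simp
    show "0 \<le> trace ((predict_cov A Q ^^ j) X)" for j using psd trace_nonneg by blast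
    fix j :: nat assume "1 \<le> j"
    then obtain i where i: "j = Suc i" by (cases j) auto
    have "q Q / (d * ?r\<^sup>2) * ?r ^ (2 * j) = q Q * ?r ^ (2 * i) / d"
      using assms(5) d unfolding i by (simp add: power2_eq_square field_simps)
    also have "\<dots> \<le> trace ((predict_cov A Q ^^ j) X)"
      using q_ge[of i] q_le[OF psd, of "Suc i"] d unfolding i
      by (simp add: divide_le_eq mult.commute)
    finally show "q Q / (d * ?r\<^sup>2) * ?r ^ (2 * j) \<le> trace ((predict_cov A Q ^^ j) X)" .
  qed
qed

section \<open>The chain of holding times\<close>

text \<open>The bind rule for nonnegative integrals carries over to real expectations because the
  bounds make every integrand integrable.\<close>

lemma integral_bind_pmf_01:
  fixes F :: "'b \<Rightarrow> real"
  assumes "\<And>x. 0 \<le> F x" "\<And>x. F x \<le> 1"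
  shows "measure_pmf.expectation (bind_pmf p K) F =
    measure_pmf.expectation p (\<lambda>x. measure_pmf.expectation (K x) F)"
proof -
  have int: "integrable (measure_pmf M) F" for M
    using assms by (intro measure_pmf.integrable_const_bound[where B = 1]) auto
  have E01: "0 \<le> measure_pmf.expectation M F" "measure_pmf.expectation M F \<le> 1" for M
    using assms int by (auto intro: integral_nonneg_AE measure_pmf.integral_le_const)
  have int': "integrable (measure_pmf p) (\<lambda>x. measure_pmf.expectation (K x) F)"
    using E01 by (intro measure_pmf.integrable_const_bound[where B = 1]) auto
  have "ennreal (measure_pmf.expectation (bind_pmf p K) F) = (\<integral>\<^sup>+x. F x \<partial>bind_pmf p K)"
    using nn_integral_eq_integral[OF int] assms(1) by (metis AE_I2)
  also have "\<dots> = (\<integral>\<^sup>+x. \<integral>\<^sup>+y. F y \<partial>K x \<partial>p)"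
    by (rule nn_integral_bind_pmf)
  also have "\<dots> = (\<integral>\<^sup>+x. measure_pmf.expectation (K x) F \<partial>p)"
    using nn_integral_eq_integral[OF int] assms by simp
  also have "\<dots> = ennreal (measure_pmf.expectation p (\<lambda>x. measure_pmf.expectation (K x) F))"
    using nn_integral_eq_integral[OF int'] E01 by simp
  finally show ?thesis using E01 by (simp add: integral_nonneg_AE)
qed

lemma set_bernoulli_pmf_iff:
  assumes "0 \<le> p" "p \<le> 1"
  shows "True \<in> set_pmf (bernoulli_pmf p) \<longleftrightarrow> 0 < p" "False \<in> set_pmf (bernoulli_pmf p) \<longleftrightarrow> p < 1"
  using assms by (auto simp: set_pmf_iff)

lemma bernoulli_pmf_one: "bernoulli_pmf 1 = return_pmf True"
  by (rule pmf_eqI) (auto simp: indicator_def split: bool.split)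

section \<open>One-step behaviour of the chain and its averaging operator\<close>

locale holding_chain =
  fixes lam lame :: real and \<tau> :: policy
  assumes lam: "0 < lam" "lam \<le> 1" and lame: "0 < lame" "lame < 1"
    and policy: "0 \<le> \<tau> i j" "\<tau> i j \<le> 1"
begin

abbreviation "step \<equiv> step_law lam lame 1 \<tau>"
abbreviation "window \<equiv> window_law lam lame 1 \<tau>"
abbreviation "law \<equiv> holding_law lam lame 1 \<tau>"
abbreviation "stationary \<equiv> stationary_law lam lame 1 \<tau>"
abbreviation "E \<equiv> measure_pmf.expectation"

text \<open>With certain acknowledgment, the sensor's time resets exactly at receptions. The second
  case covers both no transmission and one lost on both channels.\<close>

lemma step_supportE:
  assumes "(b, s') \<in> set_pmf (step (i, j))"
  obtains "b" "fst s' = 0" "0 < \<tau> i j"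
  | "\<not> b" "s' = (i + 1, j + 1)"
  | "\<not> b" "s' = (i + 1, 0)" "0 < \<tau> i j"
  using assms set_bernoulli_pmf_iff(1)[OF policy, of i j]
  by (auto simp: step_law_def bernoulli_pmf_one split: if_splits)

lemma step_support_received:
  assumes "0 < \<tau> i j"
  shows "(True, 0, 0) \<in> set_pmf (step (i, j))" "(True, 0, j + 1) \<in> set_pmf (step (i, j))"
proof -
  have "True \<in> set_pmf (bernoulli_pmf (\<tau> i j))" "True \<in> set_pmf (bernoulli_pmf lam)"
    using assms lam policy by (simp_all add: set_bernoulli_pmf_iff)
  then have "(True, 0, if b then 0 else j + 1) \<in> set_pmf (step (i, j))" for b
    unfolding step_law_def prod.case set_bind_pmf using lame
    by (intro UN_I[of True] UN_I[of b "set_pmf (if True then bernoulli_pmf lame else _)"])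
      (simp_all add: bernoulli_pmf_one)
  from this[of True] this[of False]
  show "(True, 0, 0) \<in> set_pmf (step (i, j))" "(True, 0, j + 1) \<in> set_pmf (step (i, j))"
    by simp_all
qed

text \<open>The Markov operator of the chain on functions, written out over the four outcomes of a
  transmission so that later estimates become algebra.\<close>

definition step_mean :: "(nat \<times> nat \<Rightarrow> real) \<Rightarrow> nat \<times> nat \<Rightarrow> real" where
  "step_mean F = (\<lambda>(i, j).
     \<tau> i j * (lam * lame * F (0, 0) + lam * (1 - lame) * F (0, j + 1) +
              (1 - lam) * lame * F (i + 1, 0) + (1 - lam) * (1 - lame) * F (i + 1, j + 1)) +
     (1 - \<tau> i j) * F (i + 1, j + 1))"

lemma expectation_bind_bernoulli:
  assumes "0 \<le> p" "p \<le> 1" "\<And>b. finite (set_pmf (K b))"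
  shows "E (bind_pmf (bernoulli_pmf p) K) (F :: _ \<Rightarrow> real) = p * E (K True) F + (1 - p) * E (K False) F"
  using assms by (subst pmf_expectation_bind[where A = UNIV]) (auto simp: UNIV_bool)

lemma expectation_step: "E (map_pmf snd (step s)) F = step_mean F s"
  using lam lame policy
  by (cases s) (simp add: step_law_def step_mean_def expectation_bind_bernoulli bernoulli_pmf_one
      bind_return_pmf map_bind_pmf algebra_simps)

lemma step_mean_mono: "(\<And>s. F s \<le> G s) \<Longrightarrow> step_mean F s \<le> step_mean G s"
  using lam lame policy unfolding step_mean_def
  by (auto simp: split_beta intro!: add_mono mult_left_mono)

lemma step_mean_const: "step_mean (\<lambda>_. c) s = c"
  unfolding step_mean_def by (simp add: split_beta algebra_simps)

lemma step_mean_sum: "step_mean (\<lambda>s. \<Sum>k\<in>A. F k s) s = (\<Sum>k\<in>A. step_mean (F k) s)"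
  unfolding step_mean_def
  by (simp add: split_beta sum.distrib flip: sum_distrib_left)

lemma step_mean_01:
  assumes "\<And>s. 0 \<le> F s \<and> F s \<le> 1"
  shows "0 \<le> step_mean F s \<and> step_mean F s \<le> 1"
  using step_mean_mono[of "\<lambda>_. 0" F s] step_mean_mono[of F "\<lambda>_. 1" s] assms
  by (simp add: step_mean_const)

lemma iterate_step_mean_01:
  assumes "\<And>s. 0 \<le> F s \<and> F s \<le> 1"
  shows "0 \<le> (step_mean ^^ k) F s \<and> (step_mean ^^ k) F s \<le> 1"
  by (induction k arbitrary: s) (simp_all add: assms step_mean_01)

lemma expectation_law_Suc:
  assumes "\<And>s. 0 \<le> F s \<and> F s \<le> 1"
  shows "E (law (Suc k)) F = E (law k) (step_mean F)"
  using assms by (simp add: integral_bind_pmf_01 expectation_step del: integral_map_pmf)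

text \<open>Pushing the law forward is dual to applying the operator to \<open>F\<close>; the
  induction generalises \<open>F\<close> to move one step across.\<close>

lemma expectation_law_eq_iterate:
  assumes "\<And>s. 0 \<le> F s \<and> F s \<le> 1"
  shows "E (law k) F = (step_mean ^^ k) F (0, 0)"
  using assms
proof (induction k arbitrary: F)
  case (Suc k)
  show ?case
    unfolding expectation_law_Suc[OF Suc.prems]
    using Suc.IH[of "step_mean F"] Suc.prems by (simp add: step_mean_01 funpow_swap1)
qed simp

lemma expectation_stationary:
  assumes "stationary \<pi>" "\<And>s. 0 \<le> F s \<and> F s \<le> 1"
  shows "E \<pi> (step_mean F) = E \<pi> F"
  using arg_cong[OF assms(1)[unfolded stationary_law_def], of "\<lambda>p. E p F"] assms(2)
  by (simp add: integral_bind_pmf_01 expectation_step del: integral_map_pmf)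

lemma expectation_stationary_iterate:
  assumes "stationary \<pi>" "\<And>s. 0 \<le> F s \<and> F s \<le> 1"
  shows "E \<pi> ((step_mean ^^ k) F) = E \<pi> F"
  by (induction k) (simp_all add: assms iterate_step_mean_01 expectation_stationary)

text \<open>Maximum principle: the expected number of visits to the origin up to time \<open>T\<close> is
  largest when the chain starts there.\<close>

lemma visits_le_visits_origin:
  "(\<Sum>k\<le>T. (step_mean ^^ k) (indicator {(0, 0)}) s) \<le> (\<Sum>k\<le>T. (step_mean ^^ k) (indicator {(0, 0)}) (0, 0))"
  (is "?G T s \<le> ?G T (0, 0)")
proof (induction T arbitrary: s)
  case 0
  then show ?case by (cases "s = (0, 0)") simp_all
next
  case (Suc T)
  show ?case
  proof (cases "s = (0, 0)")
    case False
    \<comment> \<open>Away from the origin the term for time 0 vanishes, so only visits after the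
      first step count.\<close>
    have "?G (Suc T) s = step_mean (?G T) s"
      using False by (simp add: sum.atMost_Suc_shift step_mean_sum del: sum.atMost_Suc)
    also have "\<dots> \<le> step_mean (\<lambda>_. ?G T (0, 0)) s" using Suc by (rule step_mean_mono)
    also have "\<dots> \<le> ?G (Suc T) (0, 0)"
      unfolding step_mean_const using iterate_step_mean_01[of "indicator {(0, 0)}" "Suc T" "(0,0)"] by simp
    finally show ?thesis .
  qed simp
qed

text \<open>The left side is the expected number of visits under a stationary start; averaging the
  maximum principle over \<open>\<pi>\<close> compares it with a start at the origin.\<close>

lemma visits_origin_ge:
  assumes "stationary \<pi>"
  shows "real (Suc T) * pmf \<pi> (0, 0) \<le> (\<Sum>k\<le>T. measure (law k) {(0, 0)})"
proof -
  let ?\<delta> = "indicator {(0, 0)} :: nat \<times> nat \<Rightarrow> real"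
  have b: "0 \<le> (step_mean ^^ k) ?\<delta> s \<and> (step_mean ^^ k) ?\<delta> s \<le> 1" for k s
    by (rule iterate_step_mean_01) simp
  have int: "integrable (measure_pmf \<pi>) ((step_mean ^^ k) ?\<delta>)" for k
    using b by (intro measure_pmf.integrable_const_bound[where B = 1]) auto
  have "real (Suc T) * pmf \<pi> (0, 0) = (\<Sum>k\<le>T. E \<pi> ((step_mean ^^ k) ?\<delta>))"
    using expectation_stationary_iterate[OF assms, of ?\<delta>] by (simp add: measure_pmf_single)
  also have "\<dots> = E \<pi> (\<lambda>s. \<Sum>k\<le>T. (step_mean ^^ k) ?\<delta> s)"
    using int by simp
  also have "\<dots> \<le> (\<Sum>k\<le>T. (step_mean ^^ k) ?\<delta> (0, 0))"
    using int visits_le_visits_origin by (intro measure_pmf.integral_le_const) auto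
  also have "\<dots> = (\<Sum>k\<le>T. measure (law k) {(0, 0)})"
    using expectation_law_eq_iterate[of ?\<delta>] by simp
  finally show ?thesis .
qed

lemma finite_law: "finite (set_pmf (law k))"
proof (induction k)
  case (Suc k)
  have "finite (set_pmf (step s))" for s
    by (cases s) (auto simp: step_law_def)
  with Suc show ?case by simp
qed simp

section \<open>Supports of stationary laws and of windows\<close>

lemma stationary_support_step:
  assumes "stationary \<pi>" "s \<in> set_pmf \<pi>" "(b, s') \<in> set_pmf (step s)"
  shows "s' \<in> set_pmf \<pi>"
proof -
  have "s' \<in> set_pmf (bind_pmf \<pi> (\<lambda>s. map_pmf snd (step s)))"
    using assms(2,3) by force
  with assms(1) show ?thesis unfolding stationary_law_def by simp
qed

lemma stationary_support_predecessor:
  assumes "stationary \<pi>" "s' \<in> set_pmf \<pi>"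
  obtains i j b where "(i, j) \<in> set_pmf \<pi>" "(b, s') \<in> set_pmf (step (i, j))"
proof -
  have "s' \<in> set_pmf (bind_pmf \<pi> (\<lambda>s. map_pmf snd (step s)))"
    using assms unfolding stationary_law_def by simp
  then show thesis using that by force
qed

text \<open>Some supported state may transmit, and reception on both channels then leads to the
  origin.\<close>

lemma origin_in_stationary_support:
  assumes "stationary \<pi>"
  shows "(0, 0) \<in> set_pmf \<pi>"
proof -
  have "\<exists>i j. (i, j) \<in> set_pmf \<pi> \<and> 0 < \<tau> i j"
  proof (rule ccontr)
    assume silent: "\<not> ?thesis"
    \<comment> \<open>Without transmissions every predecessor has a strictly smaller sensor holding
      time, an infinite descent.\<close>
    have "(n, j) \<notin> set_pmf \<pi>" for n j
    proof (induction n arbitrary: j rule: less_induct)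
      case (less n)
      show ?case
      proof
        assume "(n, j) \<in> set_pmf \<pi>"
        then obtain i j' b where *: "(i, j') \<in> set_pmf \<pi>" "(b, n, j) \<in> set_pmf (step (i, j'))"
          using stationary_support_predecessor[OF assms] by blast
        then have "i < n" using silent by (auto elim!: step_supportE)
        with less * show False by blast
      qed
    qed
    then show False using set_pmf_not_empty[of \<pi>] by auto
  qed
  then show ?thesis
    using stationary_support_step[OF assms] step_support_received(1) by blast
qed

text \<open>This transfers facts about supported states of \<open>\<pi>\<close> to the chain started
  at the origin.\<close>

lemma law_support_subset:
  assumes "stationary \<pi>"
  shows "set_pmf (law k) \<subseteq> set_pmf \<pi>"
proof (induction k)
  case 0
  then show ?case using origin_in_stationary_support[OF assms] by simp
next
  case (Suc k)
  then show ?case using stationary_support_step[OF assms] by auto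
qed

lemma window_support_Cons:
  "(b, s') \<in> set_pmf (step s) \<Longrightarrow> xs \<in> set_pmf (window n s') \<Longrightarrow> b # xs \<in> set_pmf (window (Suc n) s)"
  by force

text \<open>A state with \<open>i \<le> j\<close> was reached by \<open>i\<close> silent steps after a reception.\<close>

lemma window_after_reception:
  assumes "stationary \<pi>" "(i, j) \<in> set_pmf \<pi>" "i \<le> j"
  obtains s where "s \<in> set_pmf \<pi>"
    "\<And>n xs. xs \<in> set_pmf (window n (i, j)) \<Longrightarrow>
       True # replicate i False @ xs \<in> set_pmf (window (Suc (i + n)) s)"
  using assms(2,3)
proof (induction i arbitrary: j thesis)
  case 0
  obtain i' j' b where p: "(i', j') \<in> set_pmf \<pi>" "(b, 0, j) \<in> set_pmf (step (i', j'))"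
    using stationary_support_predecessor[OF assms(1) 0(2)] by blast
  from p(2) have b by (auto elim!: step_supportE)
  with p 0(1)[of "(i', j')"] window_support_Cons[of True] show ?case by simp
next
  case (Suc i)
  obtain i' j' b where p: "(i', j') \<in> set_pmf \<pi>" "(b, Suc i, j) \<in> set_pmf (step (i', j'))"
    using stationary_support_predecessor[OF assms(1) Suc(3)] by blast
  \<comment> \<open>\<open>Suc i \<le> j\<close> excludes a reception by the adversary in this step,
    which would give \<open>j = 0\<close>.\<close>
  from p(2) have e: "i' = i" "\<not> b" "j = Suc j'" using \<open>Suc i \<le> j\<close> by (auto elim!: step_supportE)
  obtain s where s: "s \<in> set_pmf \<pi>"
    "\<And>n xs. xs \<in> set_pmf (window n (i, j')) \<Longrightarrow>
       True # replicate i False @ xs \<in> set_pmf (window (Suc (i + n)) s)"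
    using Suc.IH[of j'] p e \<open>Suc i \<le> j\<close> by auto
  show ?case
  proof (rule Suc.prems(1)[OF s(1)])
    fix n xs assume "xs \<in> set_pmf (window n (Suc i, j))"
    then have "False # xs \<in> set_pmf (window (Suc n) (i, j'))"
      using p(2) e by (intro window_support_Cons) auto
    from s(2)[OF this] show "True # replicate (Suc i) False @ xs \<in> set_pmf (window (Suc (Suc i + n)) s)"
      by (simp add: replicate_app_Cons_same)
  qed
qed

end

text \<open>Each silent symbol adds one to the sensor's holding time, so it equals
  \<open>k + i\<close> when the received packet is sent, and the policy sends only above
  \<open>t\<close>.\<close>

lemma threshold_window_silent:
  assumes "holding_chain lam lame (threshold_policy t)"
    and "replicate i False @ True # xs \<in> set_pmf (window_law lam lame 1 (threshold_policy t) n (k, j))"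
  shows "t < k + i"
proof -
  interpret holding_chain lam lame "threshold_policy t" by fact
  show ?thesis using assms(2)
  proof (induction i arbitrary: n k j)
    case 0
    then obtain s where "(True, s) \<in> set_pmf (step (k, j))" by (cases n) auto
    then have "0 < threshold_policy t k j" by (auto elim!: step_supportE)
    then show ?case by (simp add: threshold_policy_def split: if_splits)
  next
    case (Suc i)
    then obtain m s where m: "n = Suc m" "(False, s) \<in> set_pmf (step (k, j))"
      "replicate i False @ True # xs \<in> set_pmf (window m s)"
      by (cases n) auto
    from m(2) have "fst s = Suc k" by (auto elim!: step_supportE)
    with Suc.IH[of m "fst s" "snd s"] m(3) show ?case by (cases s) simp
  qed
qed

lemma threshold_window_gap:
  assumes "holding_chain lam lame (threshold_policy t)"
    and "True # replicate i False @ True # xs \<in> set_pmf (window_law lam lame 1 (threshold_policy t) n s)"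
  shows "t < i"
proof -
  interpret holding_chain lam lame "threshold_policy t" by fact
  obtain m s' where m: "n = Suc m" "(True, s') \<in> set_pmf (step s)"
    "replicate i False @ True # xs \<in> set_pmf (window m s')"
    using assms(2) by (cases n) auto
  have "fst s' = 0" using m(2) by (cases s) (auto elim!: step_supportE)
  with threshold_window_silent[OF assms(1), of i xs m "fst s'" "snd s'"] m(3) show ?thesis
    by (cases s') simp
qed

section \<open>Silence forced by stealthiness, and occupation of the levels\<close>

context holding_chain
begin

text \<open>Otherwise two receptions separated by \<open>i\<close> silent symbols are possible in a
  malicious window, hence in a reference window, contradicting
  \<open>threshold_window_gap\<close>.\<close>

lemma silent_before_threshold:
  assumes "stationary \<pi>" "t < N"
    and "set_pmf (bind_pmf \<pi> (window N)) \<subseteq>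
      set_pmf (bind_pmf \<pi>0 (window_law lam lame 1 (threshold_policy t) N))"
    and "(i, j) \<in> set_pmf \<pi>" "i \<le> j" "i < t"
  shows "\<tau> i j = 0"
proof (rule ccontr)
  assume "\<tau> i j \<noteq> 0"
  then have pos: "0 < \<tau> i j" using policy[of i j] by linarith
  \<comment> \<open>The pattern has length \<open>i + 2\<close>, which fits since
    \<open>i < t < N\<close>; \<open>n\<close> counts the remaining symbols.\<close>
  obtain n where n: "N = Suc (i + Suc n)"
    using assms(2,6) that[of "N - i - 2"] by linarith
  obtain xs where "xs \<in> set_pmf (window n (0, 0))" using set_pmf_not_empty by fast
  then have "True # xs \<in> set_pmf (window (Suc n) (i, j))"
    using step_support_received(1)[OF pos] by (intro window_support_Cons)
  moreover obtain s where s: "s \<in> set_pmf \<pi>"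
    "\<And>n xs. xs \<in> set_pmf (window n (i, j)) \<Longrightarrow>
       True # replicate i False @ xs \<in> set_pmf (window (Suc (i + n)) s)"
    using window_after_reception[OF assms(1,4,5)] by blast
  ultimately have "True # replicate i False @ True # xs \<in> set_pmf (window N s)"
    unfolding n by blast
  then have "True # replicate i False @ True # xs \<in> set_pmf (bind_pmf \<pi> (window N))"
    using s(1) by auto
  then obtain s0 where
    "True # replicate i False @ True # xs \<in> set_pmf (window_law lam lame 1 (threshold_policy t) N s0)"
    using assms(3) by auto
  moreover have "holding_chain lam lame (threshold_policy t)"
    using lam lame by unfold_locales (auto simp: threshold_policy_def)
  ultimately show False using threshold_window_gap \<open>i < t\<close> by fastforce
qed

text \<open>
  \<open>fresh d m\<close>: a reception has just occurred, with adversary holding time at least \<open>m d\<close>.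
  \<open>aged d m\<close>: this was so at the last reception, and the adversary has received nothing since.
\<close>

definition fresh :: "nat \<Rightarrow> nat \<Rightarrow> (nat \<times> nat) set" where
  "fresh d m = {(i, j). i = 0 \<and> m * d \<le> j}"

definition aged :: "nat \<Rightarrow> nat \<Rightarrow> (nat \<times> nat) set" where
  "aged d m = {(i, j). i + m * d \<le> j}"

text \<open>From an aged state, a step received by nobody keeps the weight
  \<open>lam * (1 - lame)\<close>. A transmission requires \<open>t \<le> i\<close> and, with that
  same probability, reaches the next level with value 1. Subtracting the level \<open>m\<close>
  fresh states prepares the telescoping over time.\<close>

lemma level_increase:
  assumes silent: "\<And>i j. (i, j) = s \<Longrightarrow> i \<le> j \<Longrightarrow> i < t \<Longrightarrow> \<tau> i j = 0"
  shows "lam * (1 - lame) * indicator (aged (t + 1) m) s \<le>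
    step_mean (\<lambda>s. indicator (fresh (t + 1) (Suc m)) s +
      lam * (1 - lame) * (indicator (aged (t + 1) m) s - indicator (fresh (t + 1) m) s)) s"
proof -
  define p where "p = lam * (1 - lame)"
  define F :: "nat \<times> nat \<Rightarrow> real" where
    "F s = indicator (fresh (t + 1) (Suc m)) s +
      p * (indicator (aged (t + 1) m) s - indicator (fresh (t + 1) m) s)" for s
  have p: "0 \<le> p" using lam lame by (simp add: p_def)
  have F0: "0 \<le> F s" for s
    using p by (auto simp: F_def fresh_def aged_def indicator_def)
  obtain i j where s: "s = (i, j)" by force
  have "p * indicator (aged (t + 1) m) s \<le> step_mean F s"
  proof (cases "s \<in> aged (t + 1) m")
    case False
    then show ?thesis using step_mean_mono[of "\<lambda>_. 0" F s] F0 by (simp add: step_mean_const)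
  next
    case True
    then have a: "i + m * (t + 1) \<le> j" by (simp add: aged_def s)
    have F1: "F (i + 1, j + 1) = p" using a by (simp add: F_def aged_def fresh_def)
    have "\<tau> i j * p \<le> \<tau> i j * (p * F (0, j + 1))"
    proof (cases "i < t")
      case True
      then show ?thesis using silent[of i j] s a by simp
    next
      case False
      \<comment> \<open>Here \<open>t \<le> i\<close> and the step itself adds one, so the
        adversary's time reaches \<open>(m + 1) * (t + 1)\<close>. The aged and fresh indicators of
        level \<open>m\<close> cancel.\<close>
      then have "F (0, j + 1) = 1" using a by (simp add: F_def fresh_def aged_def)
      then show ?thesis using policy by simp
    qed
    also have "\<dots> \<le> \<tau> i j * (lam * lame * F (0, 0) + p * F (0, j + 1) +
        (1 - lam) * lame * F (i + 1, 0) + (1 - lam) * (1 - lame) * F (i + 1, j + 1))"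
    proof (intro mult_left_mono)
      have "0 \<le> lam * lame * F (0, 0)" "0 \<le> (1 - lam) * lame * F (i + 1, 0)"
        "0 \<le> (1 - lam) * (1 - lame) * F (i + 1, j + 1)"
        using lam lame F0 by simp_all
      then show "p * F (0, j + 1) \<le> lam * lame * F (0, 0) + p * F (0, j + 1) +
          (1 - lam) * lame * F (i + 1, 0) + (1 - lam) * (1 - lame) * F (i + 1, j + 1)" by linarith
    qed (rule policy)
    finally have "\<tau> i j * p + (1 - \<tau> i j) * F (i + 1, j + 1) \<le> step_mean F s"
      by (simp add: step_mean_def s p_def)
    then show ?thesis using True unfolding F1 by (simp add: algebra_simps)
  qed
  then show ?thesis unfolding F_def p_def .
qed

text \<open>Summed over time, the one-step inequality telescopes in the aged mass; the final
  remainder, at most \<open>lam * (1 - lame)\<close>, accounts for the \<open>- 1\<close>.\<close>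

lemma fresh_recursion:
  assumes silent: "\<And>k i j. (i, j) \<in> set_pmf (law k) \<Longrightarrow> i \<le> j \<Longrightarrow> i < t \<Longrightarrow> \<tau> i j = 0"
  defines "f \<equiv> \<lambda>m T. \<Sum>k\<le>T. measure (law k) (fresh (t + 1) m)"
  shows "lam * (1 - lame) * (f m T - 1) \<le> f (Suc m) T"
proof -
  define p where "p = lam * (1 - lame)"
  have p: "0 \<le> p" "p \<le> 1" using lam lame by (simp_all add: p_def mult_le_one)
  let ?a = "\<lambda>m k. measure (law k) (fresh (t + 1) m)"
  let ?b = "\<lambda>k. measure (law k) (aged (t + 1) m)"
  define F :: "nat \<times> nat \<Rightarrow> real" where
    "F s = indicator (fresh (t + 1) (Suc m)) s +
      p * (indicator (aged (t + 1) m) s - indicator (fresh (t + 1) m) s)" for s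
  have F01: "0 \<le> F s \<and> F s \<le> 1" for s
    using p by (auto simp: F_def fresh_def aged_def indicator_def)
  have int: "integrable (law k) G" for k and G :: "nat \<times> nat \<Rightarrow> real"
    by (intro integrable_measure_pmf_finite finite_law)
  have F: "E (law k) F = ?a (Suc m) k + p * (?b k - ?a m k)" for k
    unfolding F_def by (simp add: int)
  have step: "p * ?b k \<le> ?a (Suc m) (Suc k) + p * (?b (Suc k) - ?a m (Suc k))" for k
  proof -
    have "p * ?b k = E (law k) (\<lambda>s. p * indicator (aged (t + 1) m) s)" by simp
    also have "\<dots> \<le> E (law k) (step_mean F)"
    proof (rule integral_mono_AE[OF int int])
      show "AE s in law k. p * indicator (aged (t + 1) m) s \<le> step_mean F s"
        unfolding AE_measure_pmf_iff p_def F_def using silent by (intro ballI level_increase) auto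
    qed
    also have "\<dots> = E (law (Suc k)) F" using expectation_law_Suc[OF F01] by simp
    finally show ?thesis unfolding F .
  qed
  \<comment> \<open>The last term carries the level \<open>m\<close> mass still aged at time
    \<open>T\<close>.\<close>
  have "p * f m T \<le> f (Suc m) T + p * ?b T"
  proof (induction T)
    case 0
    have "?a m 0 \<le> ?b 0" by (intro measure_pmf.finite_measure_mono) (auto simp: fresh_def aged_def)
    then show ?case using p by (simp add: f_def mult_left_mono add_increasing)
  next
    case (Suc T)
    then show ?case using step[of T] by (simp add: f_def algebra_simps)
  qed
  also have "\<dots> \<le> f (Suc m) T + p" using p by (simp add: mult_left_le)
  finally show ?thesis by (simp add: p_def algebra_simps)
qed

text \<open>Level 0 contains the origin, whose visits are already bounded below. Each further level
  costs one factor and an additive loss of at most 1.\<close>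

lemma fresh_occupation_ge:
  assumes "stationary \<pi>"
    and silent: "\<And>i j. (i, j) \<in> set_pmf \<pi> \<Longrightarrow> i \<le> j \<Longrightarrow> i < t \<Longrightarrow> \<tau> i j = 0"
  shows "(lam * (1 - lame)) ^ m * (real (Suc T) * pmf \<pi> (0, 0)) - real m \<le>
    (\<Sum>k\<le>T. measure (law k) (fresh (t + 1) m))"
proof (induction m)
  case 0
  have "(\<Sum>k\<le>T. measure (law k) {(0, 0)}) \<le> (\<Sum>k\<le>T. measure (law k) (fresh (t + 1) 0))"
    by (intro sum_mono measure_pmf.finite_measure_mono) (auto simp: fresh_def)
  with visits_origin_ge[OF assms(1), of T] show ?case by simp
next
  case (Suc m)
  let ?p = "lam * (1 - lame)" and ?c = "real (Suc T) * pmf \<pi> (0, 0)"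
  have p: "0 \<le> ?p" "?p \<le> 1" using lam lame by (simp_all add: mult_le_one)
  have "?p ^ Suc m * ?c - real (Suc m) = ?p * (?p ^ m * ?c) - (real m + 1)" by simp
  also have "\<dots> \<le> ?p * (?p ^ m * ?c) - ?p * (real m + 1)"
    using mult_right_mono[OF p(2), of "real m + 1"] by (intro diff_left_mono) simp
  also have "\<dots> = ?p * ((?p ^ m * ?c - real m) - 1)" by (simp add: algebra_simps)
  also have "\<dots> \<le> ?p * ((\<Sum>k\<le>T. measure (law k) (fresh (t + 1) m)) - 1)"
    using p Suc by (intro mult_left_mono) auto
  also have "\<dots> \<le> (\<Sum>k\<le>T. measure (law k) (fresh (t + 1) (Suc m)))"
    using silent law_support_subset[OF assms(1)] by (intro fresh_recursion) blast
  finally show ?case .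
qed

text \<open>For fixed \<open>m\<close>, dividing by \<open>T\<close> and letting it grow removes the
  additive loss. A bound on the averages would then bound a geometric sequence of ratio above
  1.\<close>

lemma average_growth_unbounded:
  assumes "stationary \<pi>"
    and silent: "\<And>i j. (i, j) \<in> set_pmf \<pi> \<Longrightarrow> i \<le> j \<Longrightarrow> i < t \<Longrightarrow> \<tau> i j = 0"
    and h0: "\<And>j. 0 \<le> h j" and h: "\<And>j. 1 \<le> j \<Longrightarrow> c * r ^ (2 * j) \<le> h j"
    and "0 < c" "1 < r" and growth: "1 < lam * (1 - lame) * r ^ (2 * (t + 1))"
  shows "\<not> Bseq (\<lambda>T. (\<Sum>k=1..T. E (law k) (\<lambda>(i, j). h j)) / real T)"
proof
  let ?g = "\<lambda>k. E (law k) (\<lambda>(i, j). h j)"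
  let ?p = "lam * (1 - lame)"
  let ?q = "pmf \<pi> (0, 0)"
  assume "Bseq (\<lambda>T. (\<Sum>k=1..T. ?g k) / real T)"
  then obtain B where B: "\<And>T. \<bar>(\<Sum>k=1..T. ?g k) / real T\<bar> \<le> B"
    unfolding Bseq_def by auto
  have q: "0 < ?q" using origin_in_stationary_support[OF assms(1)] by (simp add: pmf_positive)
  \<comment> \<open>\<open>1 \<le> m\<close> forces \<open>1 \<le> j\<close> on the fresh states,
    where the bound on \<open>h\<close> applies, and excludes the origin, so time 0, absent from the
    average, contributes nothing.\<close>
  have bound: "c * (?p * r ^ (2 * (t + 1))) ^ m * ?q \<le> B" if "1 \<le> m" for m
  proof -
    let ?R = "c * r ^ (2 * (m * (t + 1)))"
    have R: "0 < ?R" using assms(5,6) by simp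
    have g: "?R * measure (law k) (fresh (t + 1) m) \<le> ?g k" for k
    proof -
      have "?R * measure (law k) (fresh (t + 1) m) = E (law k) (\<lambda>s. ?R * indicator (fresh (t + 1) m) s)"
        by simp
      also have "\<dots> \<le> ?g k"
      proof (intro integral_mono integrable_measure_pmf_finite finite_law)
        fix s :: "nat \<times> nat"
        obtain i j where s: "s = (i, j)" by force
        show "?R * indicator (fresh (t + 1) m) s \<le> (case s of (i, j) \<Rightarrow> h j)"
        proof (cases "s \<in> fresh (t + 1) m")
          case True
          then have j: "m * (t + 1) \<le> j" by (simp add: fresh_def s)
          have "?R \<le> c * r ^ (2 * j)"
            using assms(5,6) j by (intro mult_left_mono power_increasing) auto
          also have "1 \<le> j" using j that by (cases m) auto
          then have "c * r ^ (2 * j) \<le> h j" by (rule h)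
          finally show ?thesis using True s by simp
        qed (simp add: s h0)
      qed
      finally show ?thesis .
    qed
    have ineq: "?R * (?p ^ m * ?q) - ?R * real m / real T \<le> B" if "1 \<le> T" for T
    proof -
      have zero: "measure (law 0) (fresh (t + 1) m) = 0"
        using \<open>1 \<le> m\<close> by (simp add: fresh_def measure_return_pmf indicator_def)
      have "?p ^ m * (real T * ?q) - real m \<le> ?p ^ m * (real (Suc T) * ?q) - real m"
        using lam lame by (simp add: mult_left_mono mult_right_mono)
      also have "\<dots> \<le> (\<Sum>k\<le>T. measure (law k) (fresh (t + 1) m))"
        by (rule fresh_occupation_ge[OF assms(1) silent])
      also have "\<dots> = (\<Sum>k=1..T. measure (law k) (fresh (t + 1) m))"
        using zero by (simp add: atMost_atLeast0 sum.atLeast_Suc_atMost)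
      finally have "?R * (?p ^ m * (real T * ?q) - real m) \<le> ?R * (\<Sum>k=1..T. measure (law k) (fresh (t + 1) m))"
        using R by (simp only: mult_le_cancel_left_pos)
      also have "\<dots> \<le> (\<Sum>k=1..T. ?g k)"
        unfolding sum_distrib_left by (intro sum_mono g)
      also have "\<dots> \<le> B * real T" using B[of T] that by (simp add: field_simps abs_le_iff)
      finally show ?thesis using that by (simp add: field_simps)
    qed
    have "(\<lambda>T. ?R * (?p ^ m * ?q) - ?R * real m / real T) \<longlonglongrightarrow> ?R * (?p ^ m * ?q) - 0"
      by (intro tendsto_diff tendsto_const lim_const_over_n)
    then have "?R * (?p ^ m * ?q) - 0 \<le> B"
      by (rule LIMSEQ_le_const2) (use ineq in blast)
    moreover have "r ^ (2 * (m * (t + 1))) = (r ^ (2 * (t + 1))) ^ m"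
      by (simp only: power_mult[symmetric] ac_simps)
    ultimately show ?thesis by (simp only: power_mult_distrib) (simp add: mult_ac)
  qed
  obtain m where "B / (c * ?q) < (?p * r ^ (2 * (t + 1))) ^ m"
    using real_arch_pow[OF growth] by blast
  also have "\<dots> \<le> (?p * r ^ (2 * (t + 1))) ^ Suc m"
    using growth by (intro power_increasing) auto
  finally have "B < c * (?p * r ^ (2 * (t + 1))) ^ Suc m * ?q"
    using assms(5) q by (simp add: pos_divide_less_eq mult_ac)
  with bound[of "Suc m"] show False by simp
qed

end

section \<open>Unbounded cost\<close>

lemma trace_expectation_pmf:
  fixes X :: "'a \<Rightarrow> real^'n^'n"
  assumes "finite (set_pmf p)"
  shows "trace (measure_pmf.expectation p X) = measure_pmf.expectation p (\<lambda>x. trace (X x))"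
proof -
  have lin: "linear (trace :: real^'n^'n \<Rightarrow> real)"
    by (simp add: linear_iff trace_def sum.distrib sum_distrib_left)
  show ?thesis
    by (simp add: integral_measure_pmf[OF assms] linear_sum[OF lin] linear_cmul[OF lin])
qed

theorem theorem5:
  fixes A Q sqrtQ \<Sigma> Pbar :: "real^'n^'n"
    and C :: "real^'n^'m"
    and R :: "real^'m^'m"
    and P :: "nat \<Rightarrow> real^'n^'n"
    and lam lame lama \<epsilon> :: real
    and t N :: nat
  assumes "pos_semidef Q" and "pos_semidef R"
    and "pos_semidef sqrtQ" and "sqrtQ ** sqrtQ = Q"
    and "observable C A" and "controllable A sqrtQ"
    and "pos_semidef \<Sigma>" and "kalman_posterior_covs A C Q R \<Sigma> P" and "P \<longlonglongrightarrow> Pbar"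
    and "0 \<le> lam" and "lam \<le> 1"
    and "lama = 1" and "0 < lame" and "lame < 1"
    and "max_eigenvalue_modulus A > 1"
    and "1 / max_eigenvalue_modulus A ^ (2 * (t + 1)) < lam * (1 - lame)"
    and "N > t"
    and "\<epsilon> > 0"
  shows "\<not> (\<exists>\<tau> :: policy. (\<forall>i j. 0 \<le> \<tau> i j \<and> \<tau> i j \<le> 1) \<and>
             adversary_cost_finite lam lame lama \<tau> A Q Pbar \<and>
             stealthy lam lame lama (threshold_policy t) \<tau> N \<epsilon>)"
proof
  let ?r = "max_eigenvalue_modulus A"
  assume "\<exists>\<tau> :: policy. (\<forall>i j. 0 \<le> \<tau> i j \<and> \<tau> i j \<le> 1) \<and>
             adversary_cost_finite lam lame lama \<tau> A Q Pbar \<and>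
             stealthy lam lame lama (threshold_policy t) \<tau> N \<epsilon>"
  then obtain \<tau> :: policy where \<tau>: "\<And>i j. 0 \<le> \<tau> i j \<and> \<tau> i j \<le> 1"
    and finite_cost: "adversary_cost_finite lam lame 1 \<tau> A Q Pbar"
    and "stealthy lam lame 1 (threshold_policy t) \<tau> N \<epsilon>"
    using \<open>lama = 1\<close> by blast
  then obtain \<pi> \<pi>0 where \<pi>: "stationary_law lam lame 1 \<tau> \<pi>"
    and support: "set_pmf (bind_pmf \<pi> (window_law lam lame 1 \<tau> N)) \<subseteq>
      set_pmf (bind_pmf \<pi>0 (window_law lam lame 1 (threshold_policy t) N))"
    unfolding stealthy_def stationary_window_law_def by blast
  \<comment> \<open>The threshold inequality upgrades \<open>0 \<le> lam\<close> to the strict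
    positivity that the locale requires.\<close>
  have "0 < 1 / ?r ^ (2 * (t + 1))" using assms(15) by simp
  also note assms(16)
  finally have lam: "0 < lam" using assms(14) by (simp add: zero_less_mult_iff)
  interpret holding_chain lam lame \<tau>
    using lam assms(11,13,14) \<tau> by unfold_locales auto
  obtain c where "0 < c"
    and c: "\<And>j. 1 \<le> j \<Longrightarrow> c * ?r ^ (2 * j) \<le> trace ((predict_cov A Q ^^ j) Pbar)"
    and nonneg: "\<And>j. 0 \<le> trace ((predict_cov A Q ^^ j) Pbar)"
    using trace_iterated_predict_cov_ge[of Pbar sqrtQ Q A] assms(3,4,6,15)
      pos_semidef_kalman_limit[OF assms(1,2,7,8,9)] by auto
  have trace_mean: "trace (adversary_expected_cov lam lame 1 \<tau> A Q Pbar k) =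
      E (law k) (\<lambda>(i, j). trace ((predict_cov A Q ^^ j) Pbar))" for k
    unfolding adversary_expected_cov_def trace_expectation_pmf[OF finite_law]
    by (simp add: case_prod_unfold)
  have "\<not> Bseq (\<lambda>T. (\<Sum>k=1..T. E (law k) (\<lambda>(i, j). trace ((predict_cov A Q ^^ j) Pbar))) / real T)"
  proof (rule average_growth_unbounded[OF \<pi> _ nonneg c \<open>0 < c\<close> assms(15)])
    show "1 < lam * (1 - lame) * ?r ^ (2 * (t + 1))"
      using assms(15,16) by (simp add: divide_less_eq)
    show "\<tau> i j = 0" if "(i, j) \<in> set_pmf \<pi>" "i \<le> j" "i < t" for i j
      using silent_before_threshold[OF \<pi> assms(17) support that] .
  qed
  \<comment> \<open>A finite limit would make the averages bounded.\<close>
  moreover have "Bseq (adversary_average_cost lam lame 1 \<tau> A Q Pbar)"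
    using finite_cost unfolding adversary_cost_finite_def by (rule convergent_imp_Bseq)
  ultimately show False by (simp add: adversary_average_cost_def[abs_def] trace_mean)
qed

end
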